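(* Consider the interconnected polynomial differential-algebraic system described in the context, $$\dot z_i = F_i(z_i)+H_i(z),\qquad 0=G_i(z_i),\qquad i=1,\dots,S,$$ with full state $z\in\mathbb{R}^m$, subsystem states $z_i\in\mathbb{R}^{m_i}$, neighbor sets $\mathcal{N}_i$, and subsystem Lyapunov functions $V_i$. Suppose that for every $i\in\{1,\dots,S\}$ there is a strictly monotonically decreasing sequence of scalars $\{\epsilon_i^k\}_{k=0,1,2,\dots}$ with $\epsilon_i^0\in(0,1]$, such that for all $i\in\{1,\dots,S\}$ and all $k\in\{0,1,2,\dots\}$ $$\nabla V_i(z_i)^T\bigl(F_i(z_i)+H_i(z)\bigr)<0\qquad\text{for all } z\in\mathcal{D}_i^k,$$ where, with $\bar m_i=\sum_{j\in\mathcal{N}_i}m_j$ and $z=(z_j)_{j\in\mathcal{N}_i}$, $$\mathcal{D}_i^k:=\left\{ z\in\mathbb{R}^{\bar m_i}\ \middle|\ \begin{array}{l}\epsilon_i^{k+1}\le V_i(z_i)\le \epsilon_i^k,\\ V_j(z_j)\le \epsilon_j^k\ \text{ for all } j\in\mathcal{N}_i\setminus\{i\},\\ G_j(z_j)=0\ \text{ for all } j\in\mathcal{N}_i\end{array}\right\}.$$ Then: (a) if $\lim_{k\to+\infty}\epsilon_i^k=0$ for all $i$, the full system is asymptotically stable in the domain $$\left\{z\in\mathbb{R}^m\ \middle|\ V_i(z_i)\le\epsilon_i^0\ \text{and}\ G_i(z_i)=0\ \text{for all } i=1,\dots,S\right\};$$ (b) if this limit condition does not hold, the system is stable in the sense of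 Lyapunov.
   Context: Full system: $\dot z=F(z)$, $0=G(z)$, with $z\in\mathbb{R}^m$ and $F:\mathbb{R}^m\to\mathbb{R}^m$, $G:\mathbb{R}^m\to\mathbb{R}^q$ vectors of polynomials. The origin is assumed to be a stable equilibrium point of this system; in particular $F(0)=0$ and $G(0)=0$. A trajectory is a solution $z(t)$, $t\ge 0$, satisfying both the differential and the algebraic equations for all $t\ge 0$. Decomposition: the full system is written as $S$ interacting subsystems $$\dot z_i=F_i(z_i)+H_i(z),\qquad 0=G_i(z_i),\qquad F_i(0)=0,\ H_i(0)=0,\qquad i=1,\dots,S,$$ where $z_i\in\mathbb{R}^{m_i}$ is a subvector of coordinates of $z$. Every coordinate of $z$ belongs to at least one $z_i$; the coordinate sets of different subsystems may overlap. $F_i$, $H_i$, $G_i$ are polynomial, and the equation $G(z)=0$ is the collection of all equations $G_i(z_i)=0$. The interactions have the form $H_i(z)=\sum_{j\ne i}H_{ij}(z_i,z_j)$. The neighbor set of subsystem $i$ is $\mathcal{N}_i:=\{i\}\cup\{j\mid \exists\, z_i,z_j \text{ such that } H_{ij}(z_i,z_j)\ne 0\}$, so $H_i$ depends only on $(z_j)_{j\in\mathcal{N}_i}$, and it is regarded as a function on $\mathbb{R}^{\bar m_i}$, $\bar m_i=\sum_{j\in\mathcal{N}_i}m_j$, through this formula. Subsystem Lyapunov functions: each isolated subsystem $\dot z_i=F_i(z_i)$, $0=G_i(z_i)$ is locally asymptotically stable at the origin and has a polynomial Lyapunov function $V_i:\mathbb{R}^{m_i}\to\mathbb{R}$ with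 $V_i(0)=0$, such that on a compact connected set $D_i=\{z_i\mid \beta_i-p_i(z_i)\ge 0,\ G_i(z_i)=0\}$ (with $\beta_i>0$ and $p_i$ a positive definite polynomial) one has $V_i(z_i)>0$ and $-\nabla V_i(z_i)^TF_i(z_i)>0$ for all $z_i\in D_i\setminus\{0\}$. Each $V_i$ is scaled so that the estimated region of attraction of the isolated subsystem is $\mathcal{R}_{A,i}=\{z_i\in\mathbb{R}^{m_i}\mid G_i(z_i)=0,\ V_i(z_i)\le 1\}$, and $\mathcal{R}_{A,i}\subseteq D_i$. Stability notions: "asymptotically stable in a domain" means that every trajectory $z(t)$ of the full system whose initial state lies in that domain satisfies $\lim_{t\to+\infty}V_i(z_i(t))=0$ for all $i=1,\dots,S$. "Stable in the sense of Lyapunov" means the standard Lyapunov stability of the equilibrium $z=0$ of the full system. *)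

theory Defs
  imports "HOL-Analysis.Analysis"
begin

text \<open>A subvector of \<open>z \<in> \<real>\<^sup>m\<close> with coordinate set \<open>A\<close> is represented by the vector that agrees with
  \<open>z\<close> on \<open>A\<close> and vanishes elsewhere, so that \<open>\<real>\<^sup>A\<close> becomes the coordinate subspace
  \<open>coord_space A\<close> of \<open>\<real>\<^sup>m\<close>. A polynomial map on \<open>\<real>\<^sup>A\<close> is given by a polynomial map on \<open>\<real>\<^sup>m\<close>, of
  which only the values on \<open>coord_space A\<close> matter; every polynomial on the subspace has such an
  extension.\<close>

definition coord_space :: "'n set \<Rightarrow> (real ^ 'n) set" where
  "coord_space A = {x. \<forall>c. c \<notin> A \<longrightarrow> x $ c = 0}"

definition subvec :: "'n set \<Rightarrow> real ^ 'n \<Rightarrow> real ^ 'n" where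
  "subvec A z = (\<chi> c. if c \<in> A then z $ c else 0)"

text \<open>For \<open>w\<close> in \<open>coord_space A\<close>, the number \<open>gradient f x \<bullet> w\<close> involves only the partial derivatives
  of \<open>f\<close> in the coordinates in \<open>A\<close>; hence it agrees with the product formed in \<open>\<real>\<^sup>A\<close>.\<close>

definition gradient :: "('a::real_inner \<Rightarrow> real) \<Rightarrow> 'a \<Rightarrow> 'a" where
  "gradient f x = (THE d. GDERIV f x :> d)"

text \<open>The system \<open>x' = f x\<close>, \<open>0 = g x\<close> with state space \<open>X\<close>. At \<open>t = 0\<close> the derivative is
  one-sided.\<close>

definition trajectory ::
  "'a::real_normed_vector set \<Rightarrow> ('a \<Rightarrow> 'a) \<Rightarrow> ('a \<Rightarrow> 'b::zero) \<Rightarrow> (real \<Rightarrow> 'a) \<Rightarrow> bool" where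
  "trajectory X f g x \<longleftrightarrow>
     (\<forall>t\<ge>0. x t \<in> X \<and> (x has_vector_derivative f (x t)) (at t within {0..}) \<and> g (x t) = 0)"

definition lyapunov_stable ::
  "'a::real_normed_vector set \<Rightarrow> ('a \<Rightarrow> 'a) \<Rightarrow> ('a \<Rightarrow> 'b::zero) \<Rightarrow> bool" where
  "lyapunov_stable X f g \<longleftrightarrow>
     (\<forall>e>0. \<exists>d>0. \<forall>x. trajectory X f g x \<and> norm (x 0) < d \<longrightarrow> (\<forall>t\<ge>0. norm (x t) < e))"

definition locally_asymptotically_stable ::
  "'a::real_normed_vector set \<Rightarrow> ('a \<Rightarrow> 'a) \<Rightarrow> ('a \<Rightarrow> 'b::zero) \<Rightarrow> bool" where
  "locally_asymptotically_stable X f g \<longleftrightarrow> lyapunov_stable X f g \<and>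
     (\<exists>d>0. \<forall>x. trajectory X f g x \<and> norm (x 0) < d \<longrightarrow> (x \<longlongrightarrow> 0) at_top)"

definition neighbors ::
  "('s \<Rightarrow> 'm set) \<Rightarrow> ('s \<Rightarrow> 's \<Rightarrow> (real ^ 'm) \<times> (real ^ 'm) \<Rightarrow> real ^ 'm) \<Rightarrow> 's \<Rightarrow> 's set" where
  "neighbors I H i = {i} \<union>
     {j. j \<noteq> i \<and> (\<exists>x \<in> coord_space (I i). \<exists>y \<in> coord_space (I j). H i j (x, y) \<noteq> 0)}"

text \<open>The interaction term of subsystem \<open>i\<close>, as a function of the family of subsystem states indexed
  by \<open>J\<close>: \<open>J = UNIV\<close> for the full system, and \<open>J = neighbors I H i\<close> for the same term viewed as a
  function of the neighbor states only.\<close>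

definition interaction ::
  "('s \<Rightarrow> 's \<Rightarrow> (real ^ 'm) \<times> (real ^ 'm) \<Rightarrow> real ^ 'm) \<Rightarrow> 's \<Rightarrow> 's set \<Rightarrow> ('s \<Rightarrow> real ^ 'm) \<Rightarrow> real ^ 'm"
  where "interaction H i J \<zeta> = (\<Sum>j \<in> J - {i}. H i j (\<zeta> i, \<zeta> j))"

definition lyapunov_domain ::
  "'m set \<Rightarrow> (real ^ 'm \<Rightarrow> 'b::zero) \<Rightarrow> real \<Rightarrow> (real ^ 'm \<Rightarrow> real) \<Rightarrow> (real ^ 'm) set" where
  "lyapunov_domain A g b p = {x \<in> coord_space A. b - p x \<ge> 0 \<and> g x = 0}"

definition attraction_estimate ::
  "'m set \<Rightarrow> (real ^ 'm \<Rightarrow> 'b::zero) \<Rightarrow> (real ^ 'm \<Rightarrow> real) \<Rightarrow> (real ^ 'm) set" where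
  "attraction_estimate A g v = {x \<in> coord_space A. g x = 0 \<and> v x \<le> 1}"

text \<open>The full system is given by \<open>F\<close> and \<open>G\<close>. Subsystem \<open>i\<close> has the state coordinates \<open>I i\<close> and the
  algebraic equations \<open>Q i\<close>; the sets \<open>I i\<close> (and \<open>Q i\<close>) of different subsystems may overlap. The
  assumptions on \<open>H i j\<close> are restricted to \<open>j \<noteq> i\<close> since \<open>H i i\<close> does not occur in the system.

  Lyapunov stability of the origin is a standing assumption on the full system. It does not follow from
  decrease of each \<open>V i\<close> on shells whose levels stay away from \<open>0\<close>: these shells do not meet a
  neighborhood of the origin.\<close>

locale interconnected_dae =
  fixes F :: "real ^ 'm \<Rightarrow> real ^ 'm"
    and G :: "real ^ 'm \<Rightarrow> real ^ 'q"
    and I :: "'s::finite \<Rightarrow> 'm set"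
    and Q :: "'s \<Rightarrow> 'q set"
    and Fs :: "'s \<Rightarrow> real ^ 'm \<Rightarrow> real ^ 'm"
    and H :: "'s \<Rightarrow> 's \<Rightarrow> (real ^ 'm) \<times> (real ^ 'm) \<Rightarrow> real ^ 'm"
    and Gs :: "'s \<Rightarrow> real ^ 'm \<Rightarrow> real ^ 'q"
    and V :: "'s \<Rightarrow> real ^ 'm \<Rightarrow> real"
    and \<beta> :: "'s \<Rightarrow> real"
    and p :: "'s \<Rightarrow> real ^ 'm \<Rightarrow> real"
  assumes polynomial_F: "polynomial_function F"
    and polynomial_G: "polynomial_function G"
    and equilibrium: "F 0 = 0" "G 0 = 0"
    and stable: "lyapunov_stable UNIV F G"
    and covers_states: "(\<Union>i. I i) = UNIV"
    and covers_equations: "(\<Union>i. Q i) = UNIV"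
    and polynomial_Fs: "\<And>i. polynomial_function (Fs i)"
    and polynomial_H: "\<And>i j. j \<noteq> i \<Longrightarrow> polynomial_function (H i j)"
    and polynomial_Gs: "\<And>i. polynomial_function (Gs i)"
    and range_Fs: "\<And>i. Fs i \<in> coord_space (I i) \<rightarrow> coord_space (I i)"
    and range_H: "\<And>i j. j \<noteq> i \<Longrightarrow>
        H i j \<in> coord_space (I i) \<times> coord_space (I j) \<rightarrow> coord_space (I i)"
    and range_Gs: "\<And>i. Gs i \<in> coord_space (I i) \<rightarrow> coord_space (Q i)"
    and Fs_0: "\<And>i. Fs i 0 = 0"
    and interaction_0: "\<And>i. interaction H i UNIV (\<lambda>_. 0) = 0"
    and decomposition_F: "\<And>i z. subvec (I i) (F z) =
        Fs i (subvec (I i) z) + interaction H i UNIV (\<lambda>j. subvec (I j) z)"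
    and decomposition_G: "\<And>i z. subvec (Q i) (G z) = Gs i (subvec (I i) z)"
    and isolated_stable: "\<And>i. locally_asymptotically_stable (coord_space (I i)) (Fs i) (Gs i)"
    and polynomial_V: "\<And>i. real_polynomial_function (V i)"
    and V_0: "\<And>i. V i 0 = 0"
    and \<beta>_pos: "\<And>i. \<beta> i > 0"
    and polynomial_p: "\<And>i. real_polynomial_function (p i)"
    and p_0: "\<And>i. p i 0 = 0"
    and p_pos: "\<And>i x. x \<in> coord_space (I i) - {0} \<Longrightarrow> p i x > 0"
    and compact_domain: "\<And>i. compact (lyapunov_domain (I i) (Gs i) (\<beta> i) (p i))"
    and connected_domain: "\<And>i. connected (lyapunov_domain (I i) (Gs i) (\<beta> i) (p i))"
    and V_pos: "\<And>i x. x \<in> lyapunov_domain (I i) (Gs i) (\<beta> i) (p i) - {0} \<Longrightarrow> V i x > 0"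
    and V_decreasing: "\<And>i x. x \<in> lyapunov_domain (I i) (Gs i) (\<beta> i) (p i) - {0} \<Longrightarrow>
        - (gradient (V i) x \<bullet> Fs i x) > 0"
    and estimate_subset: "\<And>i. attraction_estimate (I i) (Gs i) (V i)
        \<subseteq> lyapunov_domain (I i) (Gs i) (\<beta> i) (p i)"

text \<open>The points are families of states of the neighbors of \<open>i\<close>, with independent entries: overlapping
  subsystem states are not required to agree on their common coordinates.\<close>

definition shell ::
  "('s \<Rightarrow> 'm set) \<Rightarrow> ('s \<Rightarrow> 's \<Rightarrow> (real ^ 'm) \<times> (real ^ 'm) \<Rightarrow> real ^ 'm) \<Rightarrow>
   ('s \<Rightarrow> real ^ 'm \<Rightarrow> 'b::zero) \<Rightarrow> ('s \<Rightarrow> real ^ 'm \<Rightarrow> real) \<Rightarrow> ('s \<Rightarrow> nat \<Rightarrow> real) \<Rightarrow>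
   's \<Rightarrow> nat \<Rightarrow> ('s \<Rightarrow> real ^ 'm) set" where
  "shell I H Gs V \<epsilon> i k =
     {\<zeta> \<in> (\<Pi>\<^sub>E j \<in> neighbors I H i. coord_space (I j)).
        \<epsilon> i (Suc k) \<le> V i (\<zeta> i) \<and> V i (\<zeta> i) \<le> \<epsilon> i k \<and>
        (\<forall>j \<in> neighbors I H i - {i}. V j (\<zeta> j) \<le> \<epsilon> j k) \<and>
        (\<forall>j \<in> neighbors I H i. Gs j (\<zeta> j) = 0)}"

text \<open>Convergence is measured by the Lyapunov functions of the subsystems, not by the norm of the
  state.\<close>

definition asymptotically_stable_in ::
  "(real ^ 'm \<Rightarrow> real ^ 'm) \<Rightarrow> (real ^ 'm \<Rightarrow> 'b::zero) \<Rightarrow> ('s \<Rightarrow> 'm::finite set) \<Rightarrow>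
   ('s \<Rightarrow> real ^ 'm \<Rightarrow> real) \<Rightarrow> (real ^ 'm) set \<Rightarrow> bool" where
  "asymptotically_stable_in F G I V D \<longleftrightarrow>
     (\<forall>z. trajectory UNIV F G z \<and> z 0 \<in> D \<longrightarrow>
        (\<forall>i. ((\<lambda>t. V i (subvec (I i) (z t))) \<longlongrightarrow> 0) at_top))"

end

theory Submission
  imports Defs
begin

text \<open>Part (b) is the standing assumption that the origin is a stable equilibrium. The content is
  part (a), which is a cascade. Along a trajectory put \<open>v i t = V i (z\<^sub>i(t))\<close>, and call the
  condition \<open>v j t \<le> \<epsilon> j k\<close> for all \<open>j\<close> level \<open>k\<close>. While level \<open>k\<close> holds, every \<open>v i\<close> that is still
  above \<open>\<epsilon> i (k + 1)\<close> has its subsystem in shell \<open>k\<close> and therefore decreases.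

  Level \<open>k\<close> cannot be left: at a first exit some \<open>v i\<close> would sit on its bound \<open>\<epsilon> i k\<close> with a negative
  derivative, while the other \<open>v j\<close> do not exceed their bounds (lemma \<open>strict_barrier\<close>).
  Level \<open>k + 1\<close> is reached in finite time: the states of level \<open>k\<close> with \<open>v i \<ge> \<epsilon> i (k + 1)\<close> form a
  compact set, because under the algebraic equations the sublevel sets of \<open>V i\<close> up to level \<open>1\<close> lie
  in the compact domain of \<open>V i\<close>, and the subsystem states determine the full state. On a compact set the decrease has a positive
  rate (lemma \<open>uniform_decrease_rate\<close>), so \<open>v i\<close> falls below \<open>\<epsilon> i (k + 1)\<close>, and stays there, by the
  barrier argument for \<open>v i\<close> alone. By induction every level is eventually attained
  (lemma \<open>cascade\<close>), and since \<open>V i\<close> is nonnegative on its domain, \<open>\<epsilon> i k \<longlonglongrightarrow> 0\<close> forces \<open>v i t\<close> to \<open>0\<close>.\<close>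

section \<open>Differential inequalities on a half-line\<close>

text \<open>The bounds form one joint barrier: the derivative of \<open>v i\<close> on its bound is controlled only where
  the remaining functions satisfy theirs, so the first exit of the whole family has to be considered.\<close>

lemma strict_barrier:
  fixes v v' :: "'i \<Rightarrow> real \<Rightarrow> real"
  assumes "finite J" and "0 \<le> T"
    and deriv: "\<And>i t. i \<in> J \<Longrightarrow> 0 \<le> t \<Longrightarrow> (v i has_real_derivative v' i t) (at t within {0..})"
    and start: "\<And>i. i \<in> J \<Longrightarrow> v i T \<le> c i"
    and inward: "\<And>i t. i \<in> J \<Longrightarrow> T \<le> t \<Longrightarrow> (\<And>j. j \<in> J \<Longrightarrow> v j t \<le> c j) \<Longrightarrow> v i t = c i
                   \<Longrightarrow> v' i t < 0"
    and "i \<in> J" and "T \<le> t"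
  shows "v i t \<le> c i"
proof (rule ccontr)
  assume "\<not> v i t \<le> c i"
  \<comment> \<open>At \<open>r\<close>, the infimum of the times at which a bound is violated, all bounds still hold.\<close>
  define S where "S = {s. T \<le> s \<and> (\<exists>j\<in>J. c j < v j s)}"
  define r where "r = Inf S"
  have "t \<in> S" using \<open>\<not> v i t \<le> c i\<close> \<open>i \<in> J\<close> \<open>T \<le> t\<close> by (auto simp: S_def not_le)
  have bdd: "bdd_below S" unfolding S_def by (rule bdd_belowI[of _ T]) auto
  have "T \<le> r" unfolding r_def using \<open>t \<in> S\<close> by (intro cInf_greatest) (auto simp: S_def)
  have before: "v j s \<le> c j" if "j \<in> J" "T \<le> s" "s < r" for j s
    using that cInf_lower[OF _ bdd, of s] by (force simp: S_def r_def not_less)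
  have isCont_r: "continuous (at r within {0..}) (v j)" if "j \<in> J" for j
    using deriv[OF that, of r] \<open>0 \<le> T\<close> \<open>T \<le> r\<close> by (intro DERIV_continuous) auto
  have at_r: "v j r \<le> c j" if "j \<in> J" for j
  proof (cases "r = T")
    case True
    then show ?thesis using start that by simp
  next
    case False
    then have "T < r" using \<open>T \<le> r\<close> by simp
    have "(v j \<longlongrightarrow> v j r) (at r within {T<..<r})"
      using isCont_r[OF that, unfolded continuous_within]
      by (rule tendsto_within_subset) (use \<open>0 \<le> T\<close> in auto)
    moreover have "at r within {T<..<r} \<noteq> bot"
      using \<open>T < r\<close> by (simp add: at_within_eq_bot_iff)
    moreover have "eventually (\<lambda>s. v j s \<le> c j) (at r within {T<..<r})"
      by (auto simp: eventually_at_filter intro!: always_eventually before that)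
    ultimately show ?thesis by (metis tendsto_upperbound)
  qed
  \<comment> \<open>Each bound survives past \<open>r\<close>: by the negative derivative where it is attained, by continuity
    where it is strict. Finiteness of \<open>J\<close> gives a common time span, so \<open>r\<close> is not the infimum.\<close>
  have "\<exists>d>0. \<forall>h>0. h < d \<longrightarrow> v j (r + h) \<le> c j" if j: "j \<in> J" for j
  proof (cases "v j r = c j")
    case True
    have "v' j r < 0" using inward[OF j \<open>T \<le> r\<close> at_r True] .
    from has_real_derivative_neg_dec_right[OF deriv[OF j] this]
    show ?thesis using \<open>0 \<le> T\<close> \<open>T \<le> r\<close> True by (force intro: less_imp_le)
  next
    case False
    then have "v j r < c j" using at_r[OF j] by simp
    with isCont_r[OF j] have "eventually (\<lambda>s. v j s < c j) (at r within {0..})"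
      unfolding continuous_within by (rule order_tendstoD)
    then obtain d where "d > 0" "\<And>s. s \<in> {0..} \<Longrightarrow> s \<noteq> r \<Longrightarrow> dist s r < d \<Longrightarrow> v j s < c j"
      unfolding eventually_at by blast
    then show ?thesis using \<open>0 \<le> T\<close> \<open>T \<le> r\<close>
      by (intro exI[of _ d]) (auto simp: dist_real_def intro!: less_imp_le)
  qed
  then obtain d where d: "\<And>j. j \<in> J \<Longrightarrow> 0 < d j"
      "\<And>j h. j \<in> J \<Longrightarrow> 0 < h \<Longrightarrow> h < d j \<Longrightarrow> v j (r + h) \<le> c j"
    by metis
  define e where "e = Min (d ` J)"
  have "J \<noteq> {}" using \<open>i \<in> J\<close> by auto
  then have "0 < e" using d(1) \<open>finite J\<close> by (simp add: e_def)
  have "r + e \<le> s" if "s \<in> S" for s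
  proof (rule ccontr)
    assume "\<not> r + e \<le> s"
    have "r \<le> s" using cInf_lower[OF that bdd] by (simp add: r_def)
    obtain j where j: "j \<in> J" "c j < v j s" using \<open>s \<in> S\<close> by (auto simp: S_def)
    have "s \<noteq> r" using j at_r[of j] by auto
    have "e \<le> d j" using j(1) \<open>finite J\<close> by (simp add: e_def)
    then have "v j (r + (s - r)) \<le> c j"
      using d(2)[OF j(1), of "s - r"] \<open>r \<le> s\<close> \<open>s \<noteq> r\<close> \<open>\<not> r + e \<le> s\<close> by simp
    then show False using j(2) by simp
  qed
  then have "r + e \<le> r" using \<open>t \<in> S\<close> cInf_greatest[of S "r + e"] by (auto simp: r_def)
  then show False using \<open>0 < e\<close> by simp
qed

lemma reaches_level:
  fixes v v' :: "real \<Rightarrow> real"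
  assumes "0 \<le> T" and "0 < b"
    and deriv: "\<And>t. 0 \<le> t \<Longrightarrow> (v has_real_derivative v' t) (at t within {0..})"
    and rate: "\<And>t. T \<le> t \<Longrightarrow> c \<le> v t \<Longrightarrow> v' t \<le> - b"
  shows "\<exists>t\<ge>T. v t \<le> c"
proof (rule ccontr)
  assume "\<not> ?thesis"
  then have above: "c < v t" if "T \<le> t" for t using that by force
  \<comment> \<open>At rate \<open>b\<close>, the excess over \<open>c\<close> at time \<open>T\<close> is used up by time \<open>r\<close>.\<close>
  define r where "r = T + (v T - c) / b"
  have "T < r" using above[of T] \<open>0 < b\<close> by (simp add: r_def)
  have "(v has_derivative (\<lambda>h. v' s * h)) (at s within {T..r})" if "T \<le> s" "s \<le> r" for s
    using deriv[of s] \<open>0 \<le> T\<close> that unfolding has_field_derivative_def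
    by (auto intro: has_derivative_subset)
  from mvt_simple[OF \<open>T < r\<close> this]
  obtain s where s: "T < s" "v r - v T = (r - T) * v' s" by (auto simp: mult.commute)
  have "(r - T) * v' s \<le> (r - T) * (- b)"
    using rate[of s] above[of s] s \<open>T < r\<close> by (intro mult_left_mono) auto
  also have "\<dots> = c - v T" using \<open>0 < b\<close> by (simp add: r_def)
  finally show False using s above[of r] \<open>T < r\<close> by simp
qed

text \<open>The rate \<open>b i k\<close> depends on the level, and may tend to \<open>0\<close> as \<open>k\<close> grows: only finitely many
  levels have to be passed to reach a given one. The barrier argument is used for the whole family
  to keep level \<open>0\<close>, and for a single function to keep each bound once it has been attained.\<close>

lemma cascade:
  fixes v v' :: "'i::finite \<Rightarrow> real \<Rightarrow> real"
  assumes deriv: "\<And>i t. 0 \<le> t \<Longrightarrow> (v i has_real_derivative v' i t) (at t within {0..})"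
    and start: "\<And>i. v i 0 \<le> \<epsilon> i 0"
    and decr: "\<And>i. decseq (\<epsilon> i)"
    and b_pos: "\<And>i k. 0 < b i k"
    and rate: "\<And>i k t. 0 \<le> t \<Longrightarrow> (\<And>j. v j t \<le> \<epsilon> j k) \<Longrightarrow> \<epsilon> i (Suc k) \<le> v i t \<Longrightarrow> v' i t \<le> - b i k"
  shows "\<exists>T\<ge>0. \<forall>t\<ge>T. \<forall>i. v i t \<le> \<epsilon> i k"
proof (induction k)
  case 0
  have "v i t \<le> \<epsilon> i 0" if "0 \<le> t" for i t
  proof (rule strict_barrier[where J = UNIV and T = 0 and v = v and v' = v' and c = "\<lambda>i. \<epsilon> i 0"])
    fix i t assume "0 \<le> (t::real)" "\<And>j. j \<in> UNIV \<Longrightarrow> v j t \<le> \<epsilon> j 0" "v i t = \<epsilon> i 0"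
    then show "v' i t < 0"
      using rate[of t 0 i] b_pos[of i 0] decseq_SucD[OF decr, of i 0] by simp
  qed (use deriv start that in auto)
  then show ?case by blast
next
  case (Suc k)
  then obtain T where T: "0 \<le> T" "\<And>t i. T \<le> t \<Longrightarrow> v i t \<le> \<epsilon> i k" by blast
  have "\<exists>s\<ge>T. \<forall>t\<ge>s. v i t \<le> \<epsilon> i (Suc k)" for i
  proof -
    have rate_i: "v' i t \<le> - b i k" if "T \<le> t" "\<epsilon> i (Suc k) \<le> v i t" for t
      using rate[of t k i] T that by auto
    obtain s where s: "T \<le> s" "v i s \<le> \<epsilon> i (Suc k)"
      using reaches_level[OF T(1) b_pos deriv rate_i] by blast
    have "v i t \<le> \<epsilon> i (Suc k)" if "s \<le> t" for t
    proof (rule strict_barrier[where J = "{i}" and T = s and v = v and v' = v'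
          and c = "\<lambda>i. \<epsilon> i (Suc k)"])
      fix j t assume "j \<in> {i}" "s \<le> t" "v j t = \<epsilon> j (Suc k)"
      then show "v' j t < 0" using rate_i[of t] b_pos[of i k] s(1) by simp
    qed (use deriv T s that in auto)
    then show ?thesis using s by blast
  qed
  then obtain s where s: "\<And>i. T \<le> s i" "\<And>i t. s i \<le> t \<Longrightarrow> v i t \<le> \<epsilon> i (Suc k)" by metis
  have "s i \<le> Max (range s)" for i by simp
  then show ?case using s T(1)
    by (intro exI[of _ "Max (range s)"]) (meson order_trans)
qed

section \<open>Gradients of polynomials\<close>

lemma gradient_eqI:
  assumes "GDERIV f x :> d"
  shows "gradient f x = d"
  unfolding gradient_def
proof (rule the_equality)
  show "GDERIV f x :> d" by (rule assms)
next
  fix d' assume "GDERIV f x :> d'"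
  then have "(\<lambda>h. h \<bullet> d') = (\<lambda>h. h \<bullet> d)"
    using assms unfolding gderiv_def by (rule has_derivative_unique)
  then show "d' = d" by (metis vector_eq_ldot)
qed

text \<open>Continuity of the gradient is what lets compactness turn strict decrease into a decrease at a
  positive rate.\<close>

lemma continuous_gradient_real_polynomial_function:
  fixes f :: "'a::euclidean_space \<Rightarrow> real"
  assumes "real_polynomial_function f"
  obtains g where "continuous_on UNIV g" "\<And>x. GDERIV f x :> g x"
proof -
  have "\<exists>g. continuous_on UNIV g \<and> (\<forall>x. GDERIV f x :> g x)"
    using assms
  proof (induction rule: real_polynomial_function.induct)
    case (linear f)
    then interpret bounded_linear f .
    have "f h = h \<bullet> adjoint f 1" for h
      using adjoint_works[OF linear_axioms, of h 1] by simp
    then have "(\<lambda>h. h \<bullet> adjoint f 1) = f" by auto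
    then have "GDERIV f x :> adjoint f 1" for x
      unfolding gderiv_def using bounded_linear_imp_has_derivative[OF bounded_linear_axioms] by simp
    then show ?case by (intro exI[of _ "\<lambda>_. adjoint f 1"]) auto
  next
    case (const c)
    then show ?case by (intro exI[of _ "\<lambda>_. 0"]) (auto intro: GDERIV_const)
  next
    case (add f1 f2)
    then obtain g1 g2 where g: "continuous_on UNIV g1" "\<And>x. GDERIV f1 x :> g1 x"
      "continuous_on UNIV g2" "\<And>x. GDERIV f2 x :> g2 x" by blast
    then show ?case
      by (intro exI[of _ "\<lambda>x. g1 x + g2 x"]) (auto intro: GDERIV_add continuous_on_add)
  next
    case (mult f1 f2)
    then obtain g1 g2 where g: "continuous_on UNIV g1" "\<And>x. GDERIV f1 x :> g1 x"
      "continuous_on UNIV g2" "\<And>x. GDERIV f2 x :> g2 x" by blast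
    moreover have "continuous_on UNIV f1" "continuous_on UNIV f2"
      using mult.hyps by (auto intro: continuous_on_polymonial_function simp: real_polynomial_function_eq)
    ultimately show ?case
      by (intro exI[of _ "\<lambda>x. f1 x *\<^sub>R g2 x + f2 x *\<^sub>R g1 x"])
         (auto intro: GDERIV_mult continuous_on_add continuous_on_scaleR)
  qed
  then show thesis using that by blast
qed

section \<open>Coordinate subspaces\<close>

lemma bounded_linear_subvec: "bounded_linear (subvec A :: real ^ 'n \<Rightarrow> real ^ 'n)"
proof -
  have "linear (subvec A :: real ^ 'n \<Rightarrow> real ^ 'n)"
    by (rule linearI) (auto simp: subvec_def vec_eq_iff)
  then show ?thesis by (simp add: linear_conv_bounded_linear)
qed

lemma subvec_in_coord_space: "subvec A z \<in> coord_space A"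
  by (simp add: subvec_def coord_space_def)

lemma bounded_of_bounded_subvecs:
  fixes A :: "'i::finite \<Rightarrow> 'n::finite set"
  assumes cover: "(\<Union>i. A i) = UNIV"
    and bounded: "\<And>i. bounded (B i)"
    and K: "\<And>z i. z \<in> K \<Longrightarrow> subvec (A i) z \<in> B i"
  shows "bounded K"
proof -
  obtain r where r: "\<And>i x. x \<in> B i \<Longrightarrow> norm x \<le> r i"
    using bounded unfolding bounded_iff by metis
  have "\<forall>c. \<exists>i. c \<in> A i" using cover by blast
  then obtain idx where idx: "\<And>c. c \<in> A (idx c)" by metis
  have "norm z \<le> (\<Sum>c\<in>UNIV. r (idx c))" if "z \<in> K" for z
  proof -
    have "\<bar>z $ c\<bar> \<le> r (idx c)" for c
    proof -
      have "\<bar>z $ c\<bar> = \<bar>subvec (A (idx c)) z $ c\<bar>" using idx by (simp add: subvec_def)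
      also have "\<dots> \<le> norm (subvec (A (idx c)) z)" by (rule component_le_norm_cart)
      also have "\<dots> \<le> r (idx c)" using r K that by blast
      finally show ?thesis .
    qed
    then have "(\<Sum>c\<in>UNIV. \<bar>z $ c\<bar>) \<le> (\<Sum>c\<in>UNIV. r (idx c))" by (intro sum_mono)
    then show ?thesis using norm_le_l1_cart[of z] by linarith
  qed
  then show ?thesis unfolding bounded_iff by blast
qed

section \<open>The interconnected system\<close>

lemma interaction_neighbors:
  fixes H :: "'s::finite \<Rightarrow> 's \<Rightarrow> (real ^ 'm) \<times> (real ^ 'm) \<Rightarrow> real ^ 'm"
  assumes "\<And>j. \<zeta> j \<in> coord_space (I j)"
  shows "interaction H i (neighbors I H i) (restrict \<zeta> (neighbors I H i)) = interaction H i UNIV \<zeta>"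
proof -
  have "interaction H i (neighbors I H i) (restrict \<zeta> (neighbors I H i)) =
      (\<Sum>j \<in> neighbors I H i - {i}. H i j (\<zeta> i, \<zeta> j))"
    unfolding interaction_def by (intro sum.cong) (auto simp: neighbors_def)
  also have "\<dots> = (\<Sum>j \<in> UNIV - {i}. H i j (\<zeta> i, \<zeta> j))"
    using assms by (intro sum.mono_neutral_left) (auto simp: neighbors_def)
  finally show ?thesis by (simp add: interaction_def)
qed

context interconnected_dae
begin

abbreviation sub :: "'s \<Rightarrow> real ^ 'm \<Rightarrow> real ^ 'm" where
  "sub i z \<equiv> subvec (I i) z"

lemma continuous_sub: "continuous_on UNIV (sub i)"
  by (simp add: linear_continuous_on bounded_linear_subvec)

lemma subsystem_equation: "G z = 0 \<Longrightarrow> Gs i (sub i z) = 0"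
  using decomposition_G[of i z] bounded_linear_subvec[of "Q i", THEN bounded_linear.linear]
  by (simp add: linear_0)

lemma V_nonneg:
  assumes "Gs i x = 0" "x \<in> coord_space (I i)" "V i x \<le> 1"
  shows "0 \<le> V i x"
proof (cases "x = 0")
  case True
  then show ?thesis by (simp add: V_0)
next
  case False
  have "x \<in> lyapunov_domain (I i) (Gs i) (\<beta> i) (p i)"
    using assms estimate_subset[of i] by (auto simp: attraction_estimate_def)
  then show ?thesis using V_pos[of x i] False by auto
qed

lemma V_derivative_along_trajectory:
  assumes "trajectory UNIV F G z" "0 \<le> t"
  shows "((\<lambda>t. V i (sub i (z t))) has_real_derivative
      gradient (V i) (sub i (z t)) \<bullet> sub i (F (z t))) (at t within {0..})"
proof -
  let ?x = "sub i (z t)"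
  obtain g where "\<And>x. GDERIV (V i) x :> g x"
    using continuous_gradient_real_polynomial_function[OF polynomial_V] by metis
  then have V: "(V i has_derivative (\<lambda>h. h \<bullet> gradient (V i) ?x)) (at ?x)"
    using gradient_eqI[of "V i" ?x] by (metis gderiv_def)
  have "(z has_vector_derivative F (z t)) (at t within {0..})"
    using assms by (simp add: trajectory_def)
  then have "((\<lambda>t. sub i (z t)) has_vector_derivative sub i (F (z t))) (at t within {0..})"
    by (rule bounded_linear.has_vector_derivative[OF bounded_linear_subvec])
  from has_derivative_compose[OF this[unfolded has_vector_derivative_def] V]
  show ?thesis
    by (simp add: has_field_derivative_def inner_commute mult.commute[of _ "_ \<bullet> _"])
qed

text \<open>Boundedness does not come from \<open>V\<close>, whose sublevel sets may be unbounded, but from the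
  inclusion of the estimated region of attraction in a compact domain. This is why the levels must
  not exceed \<open>1\<close>.\<close>

lemma compact_sublevel_shell:
  assumes "\<And>j. c j \<le> 1"
  shows "compact {z. G z = 0 \<and> (\<forall>j. V j (sub j z) \<le> c j) \<and> a \<le> V i (sub i z)}" (is "compact ?K")
proof -
  have contV: "continuous_on UNIV (\<lambda>z. V j (sub j z))" for j
    using continuous_on_compose[OF continuous_sub[of j], of "V j"] polynomial_V
    by (auto simp: o_def real_polynomial_function_eq
        intro: continuous_on_subset[OF continuous_on_polymonial_function])
  have "continuous_on UNIV G" using polynomial_G by (rule continuous_on_polymonial_function)
  then have "closed ?K"
    by (intro closed_Collect_conj closed_Collect_all closed_Collect_eq closed_Collect_le
        contV continuous_on_const)
  moreover have "sub j z \<in> lyapunov_domain (I j) (Gs j) (\<beta> j) (p j)" if "z \<in> ?K" for z j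
  proof -
    have "V j (sub j z) \<le> 1" using that assms[of j] by (auto intro: order_trans)
    then have "sub j z \<in> attraction_estimate (I j) (Gs j) (V j)"
      using that subvec_in_coord_space subsystem_equation by (auto simp: attraction_estimate_def)
    then show ?thesis using estimate_subset by blast
  qed
  then have "bounded ?K"
    by (rule bounded_of_bounded_subvecs[OF covers_states compact_imp_bounded[OF compact_domain]])
  ultimately show ?thesis by (simp add: compact_eq_bounded_closed)
qed

text \<open>The derivative of \<open>V i\<close> along the full system is a continuous function of the state, so on a
  compact set of states its supremum is attained and inherits the strict sign. The hypothesis on the
  shell supplies the sign: restricting the family of subsystem states to the neighbors of \<open>i\<close> gives a
  point of the shell, and the remaining subsystems contribute nothing to the interaction.\<close>

lemma uniform_decrease_rate:
  assumes \<epsilon>_le: "\<And>j. \<epsilon> j k \<le> 1"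
    and decrease: "\<And>\<zeta>. \<zeta> \<in> shell I H Gs V \<epsilon> i k \<Longrightarrow>
        gradient (V i) (\<zeta> i) \<bullet> (Fs i (\<zeta> i) + interaction H i (neighbors I H i) \<zeta>) < 0"
  shows "\<exists>b>0. \<forall>z. G z = 0 \<longrightarrow> (\<forall>j. V j (sub j z) \<le> \<epsilon> j k) \<longrightarrow> \<epsilon> i (Suc k) \<le> V i (sub i z) \<longrightarrow>
      gradient (V i) (sub i z) \<bullet> sub i (F z) \<le> - b"
proof -
  define K where "K = {z. G z = 0 \<and> (\<forall>j. V j (sub j z) \<le> \<epsilon> j k) \<and> \<epsilon> i (Suc k) \<le> V i (sub i z)}"
  define h where "h z = gradient (V i) (sub i z) \<bullet> sub i (F z)" for z
  have "compact K" unfolding K_def using \<epsilon>_le by (rule compact_sublevel_shell)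
  have neg: "h z < 0" if "z \<in> K" for z
  proof -
    define \<zeta> where "\<zeta> = restrict (\<lambda>j. sub j z) (neighbors I H i)"
    have \<zeta>_i: "\<zeta> i = sub i z" by (simp add: \<zeta>_def neighbors_def)
    have "\<zeta> \<in> shell I H Gs V \<epsilon> i k"
      using that \<zeta>_i subvec_in_coord_space subsystem_equation
      unfolding shell_def K_def \<zeta>_def by auto
    from decrease[OF this] show ?thesis
      using \<zeta>_i interaction_neighbors[of "\<lambda>j. sub j z" I H i, OF subvec_in_coord_space]
      by (simp add: h_def decomposition_F \<zeta>_def)
  qed
  have "continuous_on UNIV h"
  proof -
    obtain g where g: "continuous_on UNIV g" "\<And>x. GDERIV (V i) x :> g x"
      using continuous_gradient_real_polynomial_function[OF polynomial_V] by metis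
    have "h = (\<lambda>z. g (sub i z) \<bullet> sub i (F z))"
      using gradient_eqI[OF g(2)] by (simp add: h_def fun_eq_iff)
    moreover have "continuous_on UNIV F"
      using polynomial_F by (rule continuous_on_polymonial_function)
    ultimately show ?thesis
      by (auto intro!: continuous_on_inner continuous_on_compose2[OF g(1)]
          continuous_on_compose2[OF continuous_sub] continuous_sub)
  qed
  show ?thesis
  proof (cases "K = {}")
    case True
    then show ?thesis by (intro exI[of _ 1]) (auto simp: K_def)
  next
    case False
    obtain w where "w \<in> K" "\<And>z. z \<in> K \<Longrightarrow> h z \<le> h w"
      using continuous_attains_sup[OF \<open>compact K\<close> False
          continuous_on_subset[OF \<open>continuous_on UNIV h\<close> subset_UNIV]] by blast
    then show ?thesis using neg[of w]
      by (intro exI[of _ "- h w"]) (auto simp: K_def h_def)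
  qed
qed

lemma asymptotically_stable_in_initial_sublevel:
  assumes decr: "\<And>i. decseq (\<epsilon> i)"
    and \<epsilon>_le: "\<And>i. \<epsilon> i 0 \<le> 1"
    and lim: "\<And>i. \<epsilon> i \<longlonglongrightarrow> 0"
    and decrease: "\<And>i k \<zeta>. \<zeta> \<in> shell I H Gs V \<epsilon> i k \<Longrightarrow>
        gradient (V i) (\<zeta> i) \<bullet> (Fs i (\<zeta> i) + interaction H i (neighbors I H i) \<zeta>) < 0"
  shows "asymptotically_stable_in F G I V
      {z. \<forall>i. V i (sub i z) \<le> \<epsilon> i 0 \<and> Gs i (sub i z) = 0}"
  unfolding asymptotically_stable_in_def
proof (intro allI impI, elim conjE)
  fix z i
  assume z: "trajectory UNIV F G z"
    and z0: "z 0 \<in> {z. \<forall>i. V i (sub i z) \<le> \<epsilon> i 0 \<and> Gs i (sub i z) = 0}"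
  define v where "v j t = V j (sub j (z t))" for j t
  have G: "G (z t) = 0" if "0 \<le> t" for t using z that by (simp add: trajectory_def)
  have \<epsilon>_le': "\<epsilon> j k \<le> 1" for j k
    using decseqD[OF decr, of 0 k j] \<epsilon>_le[of j] by simp
  have "\<forall>j k. \<exists>b>0. \<forall>z. G z = 0 \<longrightarrow> (\<forall>l. V l (sub l z) \<le> \<epsilon> l k) \<longrightarrow> \<epsilon> j (Suc k) \<le> V j (sub j z) \<longrightarrow>
      gradient (V j) (sub j z) \<bullet> sub j (F z) \<le> - b"
    by (intro allI uniform_decrease_rate[OF \<epsilon>_le' decrease])
  then obtain b where b: "\<And>j k. 0 < b j k"
    "\<And>j k z. G z = 0 \<Longrightarrow> (\<forall>l. V l (sub l z) \<le> \<epsilon> l k) \<Longrightarrow> \<epsilon> j (Suc k) \<le> V j (sub j z) \<Longrightarrow>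
        gradient (V j) (sub j z) \<bullet> sub j (F z) \<le> - b j k"
    unfolding choice_iff by blast
  have levels: "\<exists>T\<ge>0. \<forall>t\<ge>T. \<forall>j. v j t \<le> \<epsilon> j k" for k
  proof (rule cascade[where b = b and
        v' = "\<lambda>j t. gradient (V j) (sub j (z t)) \<bullet> sub j (F (z t))"])
    show "(v j has_real_derivative gradient (V j) (sub j (z t)) \<bullet> sub j (F (z t))) (at t within {0..})"
      if "0 \<le> t" for j t
      using V_derivative_along_trajectory[OF z that, of j] by (simp add: v_def[abs_def])
  qed (use z0 decr b G in \<open>auto simp: v_def\<close>)
  have "(v i \<longlongrightarrow> 0) at_top"
  proof (rule order_tendstoI)
    fix a :: real assume "a < 0"
    obtain T where "0 \<le> T" "\<And>t. T \<le> t \<Longrightarrow> v i t \<le> \<epsilon> i 0" using levels[of 0] by blast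
    then have "0 \<le> v i t" if "T \<le> t" for t
      using that V_nonneg[of i "sub i (z t)"] \<epsilon>_le[of i] G subsystem_equation subvec_in_coord_space
      by (fastforce simp: v_def)
    then show "eventually (\<lambda>t. a < v i t) at_top"
      using \<open>a < 0\<close> by (auto simp: eventually_at_top_linorder intro: less_le_trans)
  next
    fix a :: real assume "0 < a"
    then obtain k where "\<epsilon> i k < a"
      using order_tendstoD(2)[OF lim[of i]] by (auto simp: eventually_sequentially)
    then show "eventually (\<lambda>t. v i t < a) at_top"
      using levels[of k] by (auto simp: eventually_at_top_linorder intro: le_less_trans)
  qed
  then show "((\<lambda>t. V i (sub i (z t))) \<longlongrightarrow> 0) at_top" by (simp add: v_def[abs_def])
qed

end

theorem lemma1:
  fixes F :: "real ^ 'm \<Rightarrow> real ^ 'm"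
    and G :: "real ^ 'm \<Rightarrow> real ^ 'q"
    and I :: "'s::finite \<Rightarrow> 'm set"
    and Q :: "'s \<Rightarrow> 'q set"
    and Fs :: "'s \<Rightarrow> real ^ 'm \<Rightarrow> real ^ 'm"
    and H :: "'s \<Rightarrow> 's \<Rightarrow> (real ^ 'm) \<times> (real ^ 'm) \<Rightarrow> real ^ 'm"
    and Gs :: "'s \<Rightarrow> real ^ 'm \<Rightarrow> real ^ 'q"
    and V :: "'s \<Rightarrow> real ^ 'm \<Rightarrow> real"
    and \<beta> :: "'s \<Rightarrow> real"
    and p :: "'s \<Rightarrow> real ^ 'm \<Rightarrow> real"
    and \<epsilon> :: "'s \<Rightarrow> nat \<Rightarrow> real"
  assumes system: "interconnected_dae F G I Q Fs H Gs V \<beta> p"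
    and strictly_decreasing: "\<And>i. monotone (<) (>) (\<epsilon> i)"
    and initial: "\<And>i. \<epsilon> i 0 \<in> {0<..1}"
    and decrease: "\<And>i k \<zeta>. \<zeta> \<in> shell I H Gs V \<epsilon> i k \<Longrightarrow>
        gradient (V i) (\<zeta> i) \<bullet> (Fs i (\<zeta> i) + interaction H i (neighbors I H i) \<zeta>) < 0"
  shows "((\<forall>i. \<epsilon> i \<longlonglongrightarrow> 0) \<longrightarrow>
           asymptotically_stable_in F G I V
             {z. \<forall>i. V i (subvec (I i) z) \<le> \<epsilon> i 0 \<and> Gs i (subvec (I i) z) = 0}) \<and>
         (\<not> (\<forall>i. \<epsilon> i \<longlonglongrightarrow> 0) \<longrightarrow> lyapunov_stable UNIV F G)"
proof -
  interpret interconnected_dae F G I Q Fs H Gs V \<beta> p by (rule system)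
  have decr: "decseq (\<epsilon> i)" for i
    using strictly_decreasing[of i]
    by (intro decseq_SucI less_imp_le) (auto simp: monotone_def)
  have "\<epsilon> i 0 \<le> 1" for i using initial[of i] by simp
  then have "asymptotically_stable_in F G I V {z. \<forall>i. V i (sub i z) \<le> \<epsilon> i 0 \<and> Gs i (sub i z) = 0}"
    if "\<forall>i. \<epsilon> i \<longlonglongrightarrow> 0"
    using that decr decrease by (intro asymptotically_stable_in_initial_sublevel) auto
  then show ?thesis using stable by blast
qed

end
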